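(* Let $\mathbf{Y}=\{Y(\mathbf{s}):\mathbf{s}\in\mathbb{Z}^d\}$ be a real-valued spatial process for which there is a conditional c.d.f. $F(\cdot|\cdot)$, not depending on $\mathbf{s}$, such that for every $\mathbf{s}\in\mathbb{Z}^d$ the conditional c.d.f. of $Y(\mathbf{s})$ given all remaining variables $\{Y(\mathbf{t}):\mathbf{t}\in\mathbb{Z}^d,\mathbf{t}\neq\mathbf{s}\}$ equals $F(\cdot|\{Y(\mathbf{t}):\mathbf{t}\in\mathcal{N}(\mathbf{s})\})$, where $\mathcal{N}(\mathbf{s})=\mathbf{s}+\mathcal{M}$ for a finite set $\mathcal{M}\subset\mathbb{Z}^d\setminus\{\mathbf{0}\}$. Let $\{A(\mathbf{s}):\mathbf{s}\in\mathbb{Z}^d\}$ be i.i.d. Uniform$(0,1)$ random variables independent of $\mathbf{Y}$, and define the generalized spatial residuals $$U(\mathbf{s})=(1-A(\mathbf{s}))\cdot F\bigl(Y(\mathbf{s})|\{Y(\mathbf{t}):\mathbf{t}\in\mathcal{N}(\mathbf{s})\}\bigr)+A(\mathbf{s})\cdot F^{-}\bigl(Y(\mathbf{s})|\{Y(\mathbf{t}):\mathbf{t}\in\mathcal{N}(\mathbf{s})\}\bigr),\qquad \mathbf{s}\in\mathbb{Z}^d.$$ Let $\{\mathcal{C}_j:j=1,\ldots,q\}$ be a collection of concliques that partition $\mathbb{Z}^d$. Then for any $j=1,\ldots,q$, the variables $\{U(\mathbf{s}):\mathbf{s}\in\mathcal{C}_j\}$ are i.i.d. Uniform$(0,1)$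 random variables.
   Context: $F^{-}(\cdot|\cdot)$ denotes the left limit of the conditional c.d.f.: $F^{-}(y|\{Y(\mathbf{t}):\mathbf{t}\in\mathcal{N}(\mathbf{s})\})=P(Y(\mathbf{s})<y\,|\,\{Y(\mathbf{t}):\mathbf{t}\in\mathcal{N}(\mathbf{s})\})$, $y\in\mathbb{R}$. The conditional distributions may be discrete, continuous, or neither. The points of $\mathcal{N}(\mathbf{s})=\mathbf{s}+\mathcal{M}$ are called the neighbors of $\mathbf{s}$. A conclique is a set $\mathcal{C}\subset\mathbb{Z}^d$ of locations such that no location in the set is a neighbor of any other location in the set, i.e. $\mathbf{t}\notin\mathcal{N}(\mathbf{s})$ for all $\mathbf{s},\mathbf{t}\in\mathcal{C}$ (single-point sets are concliques). *)

theory Defs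
  imports "HOL-Probability.Probability"
begin

definition neighbors :: "(int ^ 'd) set \<Rightarrow> int ^ 'd \<Rightarrow> (int ^ 'd) set" where
  "neighbors M s = (\<lambda>m. s + m) ` M"

definition conclique :: "(int ^ 'd) set \<Rightarrow> (int ^ 'd) set \<Rightarrow> bool" where
  "conclique M C \<longleftrightarrow> (\<forall>s\<in>C. \<forall>t\<in>C. t \<notin> neighbors M s)"

text \<open>The values at the neighbors of \<open>s\<close> are indexed by the displacement \<open>m \<in> M\<close>, so that
  configurations at different locations \<open>s\<close> can be arguments of the same function.\<close>

definition neighbor_values ::
    "(int ^ 'd) set \<Rightarrow> (int ^ 'd \<Rightarrow> 'w \<Rightarrow> real) \<Rightarrow> int ^ 'd \<Rightarrow> 'w \<Rightarrow> (int ^ 'd \<Rightarrow> real)" where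
  "neighbor_values M Y s \<omega> = (\<lambda>m\<in>M. Y (s + m) \<omega>)"

text \<open>In \<open>F x y\<close> the first argument \<open>x\<close> is the configuration of neighboring values on which one
  conditions: \<open>F x y\<close> stands for \<open>F(y | x)\<close>.\<close>

definition conditional_cdf :: "'i set \<Rightarrow> (('i \<Rightarrow> real) \<Rightarrow> real \<Rightarrow> real) \<Rightarrow> bool" where
  "conditional_cdf M F \<longleftrightarrow>
     (\<forall>x \<in> space (Pi\<^sub>M M (\<lambda>_. borel)). \<exists>D. real_distribution D \<and> F x = cdf D) \<and>
     (\<forall>y. (\<lambda>x. F x y) \<in> borel_measurable (Pi\<^sub>M M (\<lambda>_. borel)))"

definition left_limit_cdf :: "(('i \<Rightarrow> real) \<Rightarrow> real \<Rightarrow> real) \<Rightarrow> ('i \<Rightarrow> real) \<Rightarrow> real \<Rightarrow> real" where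
  "left_limit_cdf F x y = Lim (at_left y) (F x)"

definition sigma_remaining ::
    "'w measure \<Rightarrow> ('s \<Rightarrow> 'w \<Rightarrow> real) \<Rightarrow> 's \<Rightarrow> 'w measure" where
  "sigma_remaining P Y s =
     vimage_algebra (space P) (\<lambda>\<omega>. \<lambda>t\<in>-{s}. Y t \<omega>) (Pi\<^sub>M (-{s}) (\<lambda>_. borel))"

definition has_conditional_cdf ::
    "'w measure \<Rightarrow> (int ^ 'd) set \<Rightarrow> (int ^ 'd \<Rightarrow> 'w \<Rightarrow> real) \<Rightarrow>
     ((int ^ 'd \<Rightarrow> real) \<Rightarrow> real \<Rightarrow> real) \<Rightarrow> int ^ 'd \<Rightarrow> bool" where
  "has_conditional_cdf P M Y F s \<longleftrightarrow>
     (\<forall>y. AE \<omega> in P.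
        real_cond_exp P (sigma_remaining P Y s) (indicator {\<omega> \<in> space P. Y s \<omega> \<le> y}) \<omega>
          = F (neighbor_values M Y s \<omega>) y)"

definition iid_uniform :: "'w measure \<Rightarrow> ('s \<Rightarrow> 'w \<Rightarrow> real) \<Rightarrow> 's set \<Rightarrow> bool" where
  "iid_uniform P X I \<longleftrightarrow>
     prob_space.indep_vars P (\<lambda>_. borel) X I \<and>
     (\<forall>i\<in>I. distr P borel (X i) = uniform_measure lborel {0<..<1})"

definition independent_processes ::
    "'w measure \<Rightarrow> ('s \<Rightarrow> 'w \<Rightarrow> real) \<Rightarrow> ('s \<Rightarrow> 'w \<Rightarrow> real) \<Rightarrow> bool" where
  "independent_processes P X Y \<longleftrightarrow>
     prob_space.indep_var P
       (Pi\<^sub>M UNIV (\<lambda>_. borel)) (\<lambda>\<omega> s. X s \<omega>) (Pi\<^sub>M UNIV (\<lambda>_. borel)) (\<lambda>\<omega> s. Y s \<omega>)"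

definition spatial_residual ::
    "(int ^ 'd) set \<Rightarrow> ((int ^ 'd \<Rightarrow> real) \<Rightarrow> real \<Rightarrow> real) \<Rightarrow> (int ^ 'd \<Rightarrow> 'w \<Rightarrow> real) \<Rightarrow>
     (int ^ 'd \<Rightarrow> 'w \<Rightarrow> real) \<Rightarrow> int ^ 'd \<Rightarrow> 'w \<Rightarrow> real" where
  "spatial_residual M F Y A s \<omega> =
     (1 - A s \<omega>) * F (neighbor_values M Y s \<omega>) (Y s \<omega>)
     + A s \<omega> * left_limit_cdf F (neighbor_values M Y s \<omega>) (Y s \<omega>)"

end

theory Submission
  imports Defs
begin

text \<open>Integrate out the \<open>A s\<close> first: given \<open>Y\<close>, the residuals are independent, and the conditional
  probability of \<open>U s \<in> B\<close> depends on \<open>Y s\<close> and its neighboring values only. Next, within a conclique,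
  integrate out the \<open>Y s\<close> one after the other, each conditionally on all remaining variables. Each
  of these integrals equals the uniform measure of \<open>B\<close>, whatever the neighboring values, because the
  randomized probability integral transform of a distribution is uniform, whether or not the
  distribution has atoms. Hence the joint distribution is a product of uniform distributions.\<close>

section \<open>The uniform distribution on (0,1) and its c.d.f\<close>

abbreviation uniform01 :: "real measure" where
  "uniform01 \<equiv> uniform_measure lborel {0<..<1}"

lemma real_distribution_uniform01: "real_distribution uniform01"
  by (auto simp: real_distribution_def real_distribution_axioms_def intro!: prob_space_uniform_measure)

lemma measure_uniform01: "B \<in> sets borel \<Longrightarrow> measure uniform01 B = measure lborel ({0<..<1} \<inter> B)"
  by (simp add: measure_uniform_measure)

text \<open>A c.d.f. is monotone with values in [0,1], so its values close to 0 and close to 1 force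
  it to vanish to the left of 0 and to equal 1 to the right of 1.\<close>

lemma cdf_eq_clamp:
  assumes "real_distribution D" and D: "\<And>u. 0 < u \<Longrightarrow> u < 1 \<Longrightarrow> cdf D u = u"
  shows "cdf D u = max 0 (min 1 u)"
proof -
  interpret real_distribution D by fact
  consider "u \<le> 0" | "0 < u" "u < 1" | "1 \<le> u" by linarith
  then show ?thesis
  proof cases
    case 1
    have "cdf D u \<le> 0"
    proof (rule field_le_epsilon)
      fix e :: real assume "0 < e"
      \<comment> \<open>Taking the minimum with 1/2 keeps the comparison point inside (0,1), where
        \<open>D\<close> gives the value.\<close>
      then have "cdf D u \<le> cdf D (min e (1/2))" using 1 by (intro cdf_nondecreasing) auto
      also have "\<dots> = min e (1/2)" using \<open>0 < e\<close> by (intro D) auto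
      finally show "cdf D u \<le> 0 + e" by simp
    qed
    then show ?thesis using 1 cdf_nonneg[of u] by simp
  next
    case 3
    have "1 \<le> cdf D u"
    proof (rule field_le_epsilon)
      fix e :: real assume "0 < e"
      have "1 - min e (1/2) = cdf D (1 - min e (1/2))" using \<open>0 < e\<close> by (intro D[symmetric]) auto
      also have "\<dots> \<le> cdf D u" using 3 \<open>0 < e\<close> by (intro cdf_nondecreasing) auto
      finally show "1 \<le> cdf D u + e" by simp
    qed
    then show ?thesis using 3 cdf_bounded_prob[of u] by simp
  qed (simp add: D)
qed

text \<open>Both laws have the same clamped c.d.f., and a c.d.f. determines its law. Checking levels
  inside (0,1) is thus enough, which are the levels that have a quantile.\<close>

lemma eq_uniform01I:
  assumes "real_distribution D" and "\<And>u. 0 < u \<Longrightarrow> u < 1 \<Longrightarrow> cdf D u = u"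
  shows "D = uniform01"
proof (rule cdf_unique)
  have "cdf uniform01 u = u" if "0 < u" "u < 1" for u
  proof -
    have "{0<..<1} \<inter> {..u} = {0<..u}" using that by auto
    then show ?thesis using that by (simp add: cdf_def measure_uniform01)
  qed
  then show "cdf D = cdf uniform01"
    using cdf_eq_clamp[OF assms] cdf_eq_clamp[OF real_distribution_uniform01] by auto
qed (fact assms real_distribution_uniform01)+

section \<open>The randomized probability integral transform\<close>

text \<open>The left limit of the c.d.f. appears as the mass of an open half-line, which makes
  measurability easy to obtain. As \<open>a\<close> runs from 0 to 1, an atom at \<open>y\<close> is
  spread over the jump of the c.d.f. at \<open>y\<close>.\<close>

definition randomized_pit :: "real measure \<Rightarrow> real \<Rightarrow> real \<Rightarrow> real" where
  "randomized_pit D y a = (1 - a) * cdf D y + a * measure D {..<y}"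

lemma borel_measurable_randomized_pit:
  assumes "real_distribution D"
  shows "(\<lambda>(y, a). randomized_pit D y a) \<in> borel_measurable (borel \<Otimes>\<^sub>M borel)"
proof -
  interpret real_distribution D by fact
  have [measurable]: "cdf D \<in> borel_measurable borel"
    by (intro borel_measurable_mono monoI cdf_nondecreasing)
  have [measurable]: "(\<lambda>y. measure D {..<y}) \<in> borel_measurable borel"
    by (intro borel_measurable_mono monoI finite_measure_mono) auto
  show ?thesis unfolding randomized_pit_def by measurable
qed

text \<open>Let \<open>q\<close> be the smallest point at which the c.d.f. reaches \<open>u\<close>.
  Up to null sets, the transform is below \<open>u\<close> when \<open>y\<close> lies left of
  \<open>q\<close>, or when \<open>y\<close> is \<open>q\<close> and \<open>a\<close> picks the part
  of the jump below \<open>u\<close>. These two events together have probability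
  \<open>u\<close>.\<close>

lemma distr_randomized_pit:
  assumes "real_distribution D"
  shows "distr (D \<Otimes>\<^sub>M uniform01) borel (\<lambda>(y, a). randomized_pit D y a) = uniform01"
proof -
  interpret D: cdf_distribution D unfolding cdf_distribution_def by fact
  interpret U: real_distribution uniform01 by (fact real_distribution_uniform01)
  interpret DU: pair_prob_space D uniform01 ..
  let ?R = "\<lambda>(y, a). randomized_pit D y a"
  let ?T = "distr (D \<Otimes>\<^sub>M uniform01) borel ?R"
  have sets_DU [measurable_cong]: "sets (D \<Otimes>\<^sub>M uniform01) = sets (borel \<Otimes>\<^sub>M borel)"
    by (intro sets_pair_measure_cong) auto
  have space_DU [simp]: "space (D \<Otimes>\<^sub>M uniform01) = UNIV" by (simp add: space_pair_measure)
  have [measurable]: "?R \<in> borel_measurable (D \<Otimes>\<^sub>M uniform01)"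
    using borel_measurable_randomized_pit[OF assms] by (simp cong: measurable_cong_sets)
  have times: "measure (D \<Otimes>\<^sub>M uniform01) (A \<times> B) = measure D A * measure uniform01 B"
    if "A \<in> sets borel" "B \<in> sets borel" for A B
    using that by (simp add: measure_def U.emeasure_pair_measure_Times enn2real_mult)
  have T: "real_distribution ?T"
    by (intro DU.real_distribution_distr) measurable
  then interpret T: real_distribution ?T .
  \<comment> \<open>Two inequalities, because \<open>cdf D\<close> may take the value \<open>u\<close> on a whole interval beyond the quantile \<open>q\<close>,
    and bounding \<open>measure ?T {..u}\<close> from above directly would need that this interval is null.\<close>
  have quantile: "measure ?T {..<u} \<le> u \<and> u \<le> measure ?T {..u}" if u: "0 < u" "u < 1" for u
  proof -
    \<comment> \<open>\<open>D.I\<close> is the generalized inverse of the c.d.f., so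
      \<open>q\<close> is the \<open>u\<close>-quantile; \<open>p\<close> is the mass of the atom
      there, possibly 0.\<close>
    define q p where "q = D.I u" and "p = measure D {q}"
    let ?L = "{a. randomized_pit D q a < u}"
    have [measurable]: "?L \<in> sets borel"
      unfolding randomized_pit_def by measurable
    have q: "u \<le> cdf D y \<longleftrightarrow> q \<le> y" for y
      unfolding q_def using u by (intro D.pseudoinverse) auto
    have jump: "cdf D q = measure D {..<q} + p"
      unfolding cdf_def p_def ivl_disj_un(2)[symmetric] by (subst D.finite_measure_Union) auto
    have left: "measure D {..<q} \<le> u"
    proof (rule tendsto_upperbound[OF D.cdf_at_left])
      show "\<forall>\<^sub>F y in at_left q. cdf D y \<le> u"
        using q by (auto simp: eventually_at_filter intro!: always_eventually) (meson less_imp_le not_le)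
    qed simp
    have R_eq: "randomized_pit D q a = cdf D q - a * p" for a
      unfolding randomized_pit_def jump by (simp add: algebra_simps)
    \<comment> \<open>Without an atom at \<open>q\<close>, \<open>left\<close> and \<open>q\<close>
      squeeze the c.d.f. at \<open>q\<close> to the value \<open>u\<close>. With an atom,
      \<open>?L\<close> is the fraction of the jump that is still missing.\<close>
    have split: "measure D {..<q} + p * measure uniform01 ?L = u"
    proof (cases "p = 0")
      case True
      then show ?thesis using left q[of q] jump by simp
    next
      case False
      then have "p > 0" by (simp add: p_def zero_less_measure_iff)
      \<comment> \<open>The level \<open>r\<close> solves \<open>cdf D q - a * p = u\<close> for
        \<open>a\<close>; it lies in [0,1] because \<open>u\<close> lies within the jump at
        \<open>q\<close>.\<close>
      define r where "r = (cdf D q - u) / p"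
      have r: "0 \<le> r" "r \<le> 1" using \<open>p > 0\<close> left q[of q] jump by (auto simp: r_def field_simps)
      have "?L = {r<..}"
        using \<open>p > 0\<close> by (auto simp: R_eq r_def field_simps)
      moreover have "{0<..<1} \<inter> {r<..} = {r<..<1}" using r(1) by auto
      ultimately have "measure uniform01 ?L = 1 - r" using r by (simp add: measure_uniform01)
      then show ?thesis using \<open>p > 0\<close> jump by (simp add: r_def field_simps)
    qed
    have null: "measure uniform01 (- {0<..<1}) = 0" "measure uniform01 {0<..<1} = 1"
      by (simp_all add: measure_uniform01)
    have pair_sets: "A \<times> B \<in> sets (D \<Otimes>\<^sub>M uniform01)" if "A \<in> sets borel" "B \<in> sets borel" for A B
      using that by (intro pair_measureI) auto
    have "measure ?T {..<u} = measure (D \<Otimes>\<^sub>M uniform01) (?R -` {..<u})"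
      by (simp add: measure_distr)
    \<comment> \<open>Beyond \<open>q\<close>, both the c.d.f. and its left limit are at least
      \<open>u\<close>, and so is any convex combination. The combination is convex only for
      \<open>a\<close> in the unit interval, hence the additional null strip.\<close>
    also have "\<dots> \<le> measure (D \<Otimes>\<^sub>M uniform01) ({..<q} \<times> UNIV \<union> {q} \<times> ?L \<union> UNIV \<times> (- {0<..<1}))"
    proof (intro DU.finite_measure_mono subsetI)
      fix x assume "x \<in> ?R -` {..<u}"
      then obtain y a where x: "x = (y, a)" and R: "randomized_pit D y a < u" by (cases x) auto
      have False if "q < y" and a: "a \<in> {0<..<1}"
      proof -
        have "u \<le> cdf D q" by (simp add: q)
        also have F: "cdf D q \<le> measure D {..<y}"
          unfolding cdf_def using \<open>q < y\<close> by (intro D.finite_measure_mono) auto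
        finally have "u \<le> measure D {..<y}" .
        moreover have "measure D {..<y} \<le> cdf D y"
          unfolding cdf_def by (intro D.finite_measure_mono) auto
        ultimately have "(1 - a) * u + a * u \<le> randomized_pit D y a"
          unfolding randomized_pit_def using a by (intro add_mono mult_left_mono) auto
        then show False using R by (simp add: algebra_simps)
      qed
      then show "x \<in> {..<q} \<times> UNIV \<union> {q} \<times> ?L \<union> UNIV \<times> (- {0<..<1})"
        using R unfolding x by (cases y q rule: linorder_cases) auto
    qed (intro sets.Un pair_sets; measurable)
    also have "\<dots> \<le> measure (D \<Otimes>\<^sub>M uniform01) ({..<q} \<times> UNIV)
        + measure (D \<Otimes>\<^sub>M uniform01) ({q} \<times> ?L) + measure (D \<Otimes>\<^sub>M uniform01) (UNIV \<times> (- {0<..<1}))"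
      by (intro order_trans[OF measure_Un_le] add_right_mono measure_Un_le sets.Un pair_sets) auto
    also have "\<dots> = u"
      using split U.prob_space by (simp add: times null p_def)
    finally have upper: "measure ?T {..<u} \<le> u" .
    \<comment> \<open>Conversely, the two pieces of total mass \<open>u\<close> are mapped into
      \<open>{..u}\<close>: to the left of \<open>q\<close> the c.d.f. and its left limit are at
      most \<open>u\<close>.\<close>
    have "u = measure (D \<Otimes>\<^sub>M uniform01) ({..<q} \<times> {0<..<1}) + measure (D \<Otimes>\<^sub>M uniform01) ({q} \<times> ?L)"
      using split by (simp add: times null p_def)
    also have "\<dots> = measure (D \<Otimes>\<^sub>M uniform01) ({..<q} \<times> {0<..<1} \<union> {q} \<times> ?L)"
      by (intro DU.finite_measure_Union[symmetric] pair_sets) auto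
    also have "\<dots> \<le> measure (D \<Otimes>\<^sub>M uniform01) (?R -` {..u})"
    proof (intro DU.finite_measure_mono subsetI)
      fix x assume "x \<in> {..<q} \<times> {0<..<1} \<union> {q} \<times> ?L"
      then consider y a where "x = (y, a)" "y < q" "a \<in> {0<..<1}" | a where "x = (q, a)" "a \<in> ?L" by auto
      then show "x \<in> ?R -` {..u}"
      proof cases
        case 1
        have "measure D {..<y} \<le> cdf D y"
          unfolding cdf_def by (intro D.finite_measure_mono) auto
        moreover have "cdf D y \<le> u" using q[of y] 1 by simp
        ultimately have "randomized_pit D y a \<le> (1 - a) * u + a * u"
          unfolding randomized_pit_def using 1 by (intro add_mono mult_left_mono) auto
        then show ?thesis using 1 by (simp add: algebra_simps)
      qed auto
    qed (use measurable_sets[of ?R "D \<Otimes>\<^sub>M uniform01" borel "{..u}"] in simp)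
    also have "\<dots> = measure ?T {..u}"
      by (simp add: measure_distr)
    finally show ?thesis using upper by simp
  qed
  show ?thesis
  proof (rule eq_uniform01I[OF T])
    fix u :: real assume u: "0 < u" "u < 1"
    have "cdf ?T u \<le> u"
    \<comment> \<open>The closed half-line at \<open>u\<close> lies in the open one at any larger
      \<open>v\<close>, whose mass is at most \<open>v\<close>; then \<open>v\<close> decreases to
      \<open>u\<close>.\<close>
    proof (rule dense_ge_bounded[of u 1])
      fix v assume "u < v" "v < 1"
      have "cdf ?T u \<le> measure ?T {..<v}"
        unfolding cdf_def using \<open>u < v\<close> by (intro T.finite_measure_mono) auto
      also have "\<dots> \<le> v" using quantile[of v] u \<open>u < v\<close> \<open>v < 1\<close> by auto
      finally show "cdf ?T u \<le> v" .
    qed (use u in auto)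
    moreover have "u \<le> cdf ?T u" using quantile[OF u] by (auto simp: cdf_def)
    ultimately show "cdf ?T u = u" by simp
  qed
qed

section \<open>Disintegration and integration over independent variables\<close>

text \<open>Hypothesis \<open>eq\<close> says that \<open>K\<close> is a conditional law of
  \<open>V\<close> given \<open>W\<close>, tested on half-lines only. Rectangles with a half-line as
  second side form an intersection-stable generator, so the test already identifies the joint law as
  a mixture.\<close>

lemma (in prob_space) nn_integral_disintegration:
  fixes V :: "'a \<Rightarrow> real"
  assumes W [measurable]: "W \<in> measurable M N" and V [measurable]: "V \<in> borel_measurable M"
    and K [measurable]: "K \<in> N \<rightarrow>\<^sub>M prob_algebra borel"
    and eq: "\<And>E y. E \<in> sets N \<Longrightarrow> emeasure M {\<omega> \<in> space M. W \<omega> \<in> E \<and> V \<omega> \<le> y}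
      = (\<integral>\<^sup>+\<omega>. indicator E (W \<omega>) * emeasure (K (W \<omega>)) {..y} \<partial>M)"
    and f [measurable]: "f \<in> borel_measurable (N \<Otimes>\<^sub>M borel)"
  shows "(\<integral>\<^sup>+\<omega>. f (W \<omega>, V \<omega>) \<partial>M) = (\<integral>\<^sup>+\<omega>. \<integral>\<^sup>+y. f (W \<omega>, y) \<partial>K (W \<omega>) \<partial>M)"
proof -
  let ?E = "{a \<times> b |a b. a \<in> sets N \<and> b \<in> range (atMost :: real \<Rightarrow> _)}"
  \<comment> \<open>\<open>?k \<omega>\<close> is the law of a pair with first entry fixed at
    \<open>W \<omega>\<close> and second entry drawn from \<open>K (W \<omega>)\<close>.\<close>
  let ?k = "\<lambda>\<omega>. distr (K (W \<omega>)) (N \<Otimes>\<^sub>M borel) (Pair (W \<omega>))"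
  have KW [measurable]: "(\<lambda>\<omega>. K (W \<omega>)) \<in> M \<rightarrow>\<^sub>M subprob_algebra borel"
    by (intro measurable_prob_algebraD) measurable
  have k [measurable]: "?k \<in> M \<rightarrow>\<^sub>M subprob_algebra (N \<Otimes>\<^sub>M borel)"
    by (rule measurable_distr2[OF _ KW]) measurable
  have sets_K: "sets (K (W \<omega>)) = sets borel" if "\<omega> \<in> space M" for \<omega>
    using measurable_space[OF KW that] by (simp add: space_subprob_algebra)
  have Pair_W [measurable]: "Pair (W \<omega>) \<in> K (W \<omega>) \<rightarrow>\<^sub>M N \<Otimes>\<^sub>M borel" if "\<omega> \<in> space M" for \<omega>
    using measurable_space[OF W that] by (simp add: measurable_cong_sets[OF sets_K[OF that] refl])
  have sets_prod: "sets (N \<Otimes>\<^sub>M borel) = sigma_sets (space N \<times> UNIV) ?E"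
  proof -
    have "sets (N \<Otimes>\<^sub>M borel) = sets (sigma (space N \<times> space borel) ?E)"
    proof (rule sets_pair_eq)
      show "sets N = sigma_sets (space N) (sets N)" by (simp add: sets.sigma_sets_eq)
      show "sets borel = sigma_sets (space borel) (range (atMost :: real \<Rightarrow> _))"
        by (subst borel_eq_atMost) simp
      show "\<Union> (range (\<lambda>n. {..real n})) = space borel"
        using real_arch_simple by auto
      show "\<Union> {space N} = space N" by simp
    qed (use sets.sets_into_space in auto)
    also have "\<dots> = sigma_sets (space N \<times> UNIV) ?E"
      by (simp, intro sets_measure_of) (use sets.sets_into_space in auto)
    finally show ?thesis .
  qed
  have "distr M (N \<Otimes>\<^sub>M borel) (\<lambda>\<omega>. (W \<omega>, V \<omega>)) = M \<bind> ?k"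
  proof (rule measure_eqI_generator_eq)
    show "Int_stable ?E"
    proof (rule Int_stableI)
      fix S T assume "S \<in> ?E" "T \<in> ?E"
      then obtain a b x y where "S = a \<times> {..x}" "T = b \<times> {..y}" "a \<in> sets N" "b \<in> sets N" by blast
      then have "S \<inter> T = (a \<inter> b) \<times> {..min x y}" "a \<inter> b \<in> sets N" by auto
      then show "S \<inter> T \<in> ?E" by blast
    qed
    show "?E \<subseteq> Pow (space N \<times> UNIV)" using sets.sets_into_space by auto
    show "sets (distr M (N \<Otimes>\<^sub>M borel) (\<lambda>\<omega>. (W \<omega>, V \<omega>))) = sigma_sets (space N \<times> UNIV) ?E"
      using sets_prod by simp
    show "sets (M \<bind> ?k) = sigma_sets (space N \<times> UNIV) ?E"
      using sets_bind[OF sets_kernel[OF k] not_empty] sets_prod by simp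
    show "range (\<lambda>n. space N \<times> {..real n}) \<subseteq> ?E" by auto
    show "(\<Union>n. space N \<times> {..real n}) = space N \<times> UNIV" using real_arch_simple by auto
    show "emeasure (distr M (N \<Otimes>\<^sub>M borel) (\<lambda>\<omega>. (W \<omega>, V \<omega>))) (space N \<times> {..real n}) \<noteq> \<infinity>" for n
      by (simp add: emeasure_distr)
    fix S assume "S \<in> ?E"
    then obtain E y where S: "S = E \<times> {..y}" and [measurable]: "E \<in> sets N" by blast
    have [measurable]: "S \<in> sets (N \<Otimes>\<^sub>M borel)" unfolding S by measurable
    have "emeasure (distr M (N \<Otimes>\<^sub>M borel) (\<lambda>\<omega>. (W \<omega>, V \<omega>))) S
        = emeasure M {\<omega> \<in> space M. W \<omega> \<in> E \<and> V \<omega> \<le> y}"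
      by (subst emeasure_distr) (auto simp: S intro!: arg_cong[where f="emeasure M"])
    also have "\<dots> = (\<integral>\<^sup>+\<omega>. emeasure (?k \<omega>) S \<partial>M)"
      unfolding eq[OF \<open>E \<in> sets N\<close>]
    proof (rule nn_integral_cong)
      fix \<omega> assume \<omega>: "\<omega> \<in> space M"
      have "Pair (W \<omega>) -` S = (if W \<omega> \<in> E then {..y} else {})" by (auto simp: S)
      then show "indicator E (W \<omega>) * emeasure (K (W \<omega>)) {..y} = emeasure (?k \<omega>) S"
        using sets_eq_imp_space_eq[OF sets_K[OF \<omega>]] by (simp add: emeasure_distr[OF Pair_W[OF \<omega>]])
    qed
    also have "\<dots> = emeasure (M \<bind> ?k) S"
      by (rule emeasure_bind[symmetric, OF not_empty k]) measurable
    finally show "emeasure (distr M (N \<Otimes>\<^sub>M borel) (\<lambda>\<omega>. (W \<omega>, V \<omega>))) S = emeasure (M \<bind> ?k) S" .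
  qed
  moreover have "(\<integral>\<^sup>+\<omega>. f (W \<omega>, V \<omega>) \<partial>M) = (\<integral>\<^sup>+x. f x \<partial>distr M (N \<Otimes>\<^sub>M borel) (\<lambda>\<omega>. (W \<omega>, V \<omega>)))"
    by (simp add: nn_integral_distr)
  moreover have "(\<integral>\<^sup>+x. f x \<partial>(M \<bind> ?k)) = (\<integral>\<^sup>+\<omega>. \<integral>\<^sup>+x. f x \<partial>?k \<omega> \<partial>M)"
    by (rule nn_integral_bind[OF f k])
  moreover have "\<dots> = (\<integral>\<^sup>+\<omega>. \<integral>\<^sup>+y. f (W \<omega>, y) \<partial>K (W \<omega>) \<partial>M)"
    by (intro nn_integral_cong nn_integral_distr Pair_W) (simp_all add: f)
  ultimately show ?thesis by simp
qed

text \<open>The joint law of the \<open>A t\<close> and \<open>Z\<close> is a product measure, so by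
  Tonelli the \<open>A t\<close> can be integrated out with \<open>Z\<close> held fixed. This will
  serve with the whole process as \<open>Z\<close>.\<close>

lemma (in prob_space) nn_integral_prod_iid_indep:
  assumes "finite J" and U: "prob_space U" "sets U = sets S"
    and A: "indep_vars (\<lambda>_. S) A J" "\<And>t. t \<in> J \<Longrightarrow> distr M S (A t) = U"
    and AZ: "indep_var (Pi\<^sub>M J (\<lambda>_. S)) (\<lambda>\<omega>. \<lambda>t\<in>J. A t \<omega>) N Z"
    and g [measurable]: "\<And>t. t \<in> J \<Longrightarrow> g t \<in> borel_measurable (N \<Otimes>\<^sub>M S)"
  shows "(\<integral>\<^sup>+\<omega>. (\<Prod>t\<in>J. g t (Z \<omega>, A t \<omega>)) \<partial>M) = (\<integral>\<^sup>+\<omega>. (\<Prod>t\<in>J. \<integral>\<^sup>+a. g t (Z \<omega>, a) \<partial>U) \<partial>M)"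
\<comment> \<open>The product-law form of independence is applied to a nonempty index set; over the
  empty set both products are 1.\<close>
proof (cases "J = {}")
  case False
  let ?A = "\<lambda>\<omega>. \<lambda>t\<in>J. A t \<omega>" and ?S = "Pi\<^sub>M J (\<lambda>_. S)"
  interpret U: prob_space U by fact
  interpret PU: product_prob_space "\<lambda>_. U" J ..
  have [measurable]: "?A \<in> M \<rightarrow>\<^sub>M ?S" "Z \<in> M \<rightarrow>\<^sub>M N"
    using AZ by (auto dest: indep_var_rv1 indep_var_rv2)
  have sets_PU [measurable_cong]: "sets (Pi\<^sub>M J (\<lambda>_. U)) = sets ?S"
    using U(2) by (intro sets_PiM_cong) auto
  have "distr M ?S ?A = Pi\<^sub>M J (\<lambda>t. distr M S (A t))"
    using indep_vars_iff_distr_eq_PiM'[OF False, of A "\<lambda>_. S"] A(1)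
    by (auto simp: indep_vars_def2)
  also have "\<dots> = Pi\<^sub>M J (\<lambda>_. U)" using A(2) by (intro PiM_cong) auto
  finally have distr_A: "distr M ?S ?A = Pi\<^sub>M J (\<lambda>_. U)" .
  interpret Z: prob_space "distr M N Z" by (rule prob_space_distr) measurable
  interpret AZ: pair_sigma_finite "Pi\<^sub>M J (\<lambda>_. U)" "distr M N Z" ..
  have [measurable]: "(\<lambda>(a, z). \<Prod>t\<in>J. g t (z, a t)) \<in> borel_measurable (?S \<Otimes>\<^sub>M N)"
    by measurable
  have [measurable]: "(\<lambda>(a, z). \<Prod>t\<in>J. g t (z, a t)) \<in> borel_measurable (Pi\<^sub>M J (\<lambda>_. U) \<Otimes>\<^sub>M distr M N Z)"
    by (simp add: measurable_cong_sets[OF sets_pair_measure_cong[OF sets_PU sets_distr] refl])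
  have "(\<integral>\<^sup>+\<omega>. (\<Prod>t\<in>J. g t (Z \<omega>, A t \<omega>)) \<partial>M)
      = (\<integral>\<^sup>+x. (case x of (a, z) \<Rightarrow> \<Prod>t\<in>J. g t (z, a t)) \<partial>distr M (?S \<Otimes>\<^sub>M N) (\<lambda>\<omega>. (?A \<omega>, Z \<omega>)))"
    by (subst nn_integral_distr) auto
  also have "distr M (?S \<Otimes>\<^sub>M N) (\<lambda>\<omega>. (?A \<omega>, Z \<omega>)) = Pi\<^sub>M J (\<lambda>_. U) \<Otimes>\<^sub>M distr M N Z"
    using AZ unfolding indep_var_distribution_eq distr_A by simp
  also have "(\<integral>\<^sup>+x. (case x of (a, z) \<Rightarrow> \<Prod>t\<in>J. g t (z, a t)) \<partial>\<dots>)
      = (\<integral>\<^sup>+z. \<integral>\<^sup>+a. (\<Prod>t\<in>J. g t (z, a t)) \<partial>Pi\<^sub>M J (\<lambda>_. U) \<partial>distr M N Z)"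
    by (subst AZ.nn_integral_snd[symmetric]) auto
  \<comment> \<open>For fixed \<open>z\<close> each factor reads its own coordinate only, so the
    integral over the product measure factorizes.\<close>
  also have "\<dots> = (\<integral>\<^sup>+z. (\<Prod>t\<in>J. \<integral>\<^sup>+a. g t (z, a) \<partial>U) \<partial>distr M N Z)"
  proof (rule nn_integral_cong)
    fix z assume "z \<in> space (distr M N Z)"
    then have "(\<lambda>a. g t (z, a)) \<in> borel_measurable U" if "t \<in> J" for t
      using g[OF that] by (subst measurable_cong_sets[OF U(2) refl]) simp
    then show "(\<integral>\<^sup>+a. (\<Prod>t\<in>J. g t (z, a t)) \<partial>Pi\<^sub>M J (\<lambda>_. U)) = (\<Prod>t\<in>J. \<integral>\<^sup>+a. g t (z, a) \<partial>U)"
      by (intro PU.product_nn_integral_prod[OF \<open>finite J\<close>, where f="\<lambda>t a. g t (z, a)"])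
  qed
  also have "\<dots> = (\<integral>\<^sup>+\<omega>. (\<Prod>t\<in>J. \<integral>\<^sup>+a. g t (Z \<omega>, a) \<partial>U) \<partial>M)"
  proof -
    have "(\<lambda>z. \<integral>\<^sup>+a. g t (z, a) \<partial>U) \<in> borel_measurable N" if "t \<in> J" for t
      using g[OF that] by (intro U.borel_measurable_nn_integral)
        (simp add: split_def measurable_cong_sets[OF sets_pair_measure_cong[OF refl U(2)] refl])
    then have "(\<lambda>z. \<Prod>t\<in>J. \<integral>\<^sup>+a. g t (z, a) \<partial>U) \<in> borel_measurable N" by measurable
    then show ?thesis by (simp add: nn_integral_distr)
  qed
  finally show ?thesis .
qed simp

section \<open>The transform as an iterated integral and along kernels\<close>

text \<open>Uniformity of the transform with \<open>a\<close> integrated first: the measure of a set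
  in the product is the integral of the measures of its sections.\<close>

lemma nn_integral_randomized_pit:
  assumes "real_distribution D" and [measurable]: "B \<in> sets borel"
  shows "(\<integral>\<^sup>+y. emeasure uniform01 {a. randomized_pit D y a \<in> B} \<partial>D) = emeasure uniform01 B"
proof -
  interpret D: real_distribution D by fact
  interpret U: real_distribution uniform01 by (fact real_distribution_uniform01)
  let ?R = "\<lambda>(y, a). randomized_pit D y a"
  have sets_DU: "sets (D \<Otimes>\<^sub>M uniform01) = sets (borel \<Otimes>\<^sub>M borel)"
    by (intro sets_pair_measure_cong) auto
  have R: "?R \<in> borel_measurable (D \<Otimes>\<^sub>M uniform01)"
    using borel_measurable_randomized_pit[OF assms(1)] by (simp add: measurable_cong_sets[OF sets_DU refl])
  have "emeasure uniform01 B = emeasure (D \<Otimes>\<^sub>M uniform01) (?R -` B \<inter> space (D \<Otimes>\<^sub>M uniform01))"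
    by (subst distr_randomized_pit[OF assms(1), symmetric]) (simp add: emeasure_distr[OF R])
  also have "\<dots> = (\<integral>\<^sup>+y. emeasure uniform01 (Pair y -` (?R -` B \<inter> space (D \<Otimes>\<^sub>M uniform01))) \<partial>D)"
    using R by (intro U.emeasure_pair_measure_alt measurable_sets) auto
  also have "\<dots> = (\<integral>\<^sup>+y. emeasure uniform01 {a. randomized_pit D y a \<in> B} \<partial>D)"
    by (intro nn_integral_cong arg_cong[where f="emeasure uniform01"]) (auto simp: space_pair_measure)
  finally show ?thesis by simp
qed

text \<open>The measure and the endpoint of the half-line vary together. Joint measurability holds
  because the half-lines are the sections of a measurable set in the product space.\<close>

lemma borel_measurable_randomized_pit_kernel:
  assumes K: "K \<in> N \<rightarrow>\<^sub>M prob_algebra borel"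
  shows "(\<lambda>((x, y), a). randomized_pit (K x) y a) \<in> borel_measurable ((N \<Otimes>\<^sub>M borel) \<Otimes>\<^sub>M borel)"
proof -
  have [measurable]: "(\<lambda>z. K (fst z)) \<in> N \<Otimes>\<^sub>M borel \<rightarrow>\<^sub>M subprob_algebra borel"
    by (intro measurable_compose[OF measurable_fst] measurable_prob_algebraD[OF K])
  have "{w \<in> space ((N \<Otimes>\<^sub>M borel) \<Otimes>\<^sub>M borel). snd w \<le> (snd (fst w) :: real)} \<in> sets ((N \<Otimes>\<^sub>M borel) \<Otimes>\<^sub>M borel)"
    by measurable
  also have "{w \<in> space ((N \<Otimes>\<^sub>M borel) \<Otimes>\<^sub>M borel). snd w \<le> (snd (fst w) :: real)}
      = (SIGMA z:space (N \<Otimes>\<^sub>M borel). {..snd z})"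
    by (auto simp: space_pair_measure)
  finally have [measurable]: "(\<lambda>z. emeasure (K (fst z)) {..snd z}) \<in> borel_measurable (N \<Otimes>\<^sub>M borel)"
    by (rule emeasure_measurable_subprob_algebra2) measurable
  have "{w \<in> space ((N \<Otimes>\<^sub>M borel) \<Otimes>\<^sub>M borel). snd w < (snd (fst w) :: real)} \<in> sets ((N \<Otimes>\<^sub>M borel) \<Otimes>\<^sub>M borel)"
    by measurable
  also have "{w \<in> space ((N \<Otimes>\<^sub>M borel) \<Otimes>\<^sub>M borel). snd w < (snd (fst w) :: real)}
      = (SIGMA z:space (N \<Otimes>\<^sub>M borel). {..<snd z})"
    by (auto simp: space_pair_measure)
  finally have [measurable]: "(\<lambda>z. emeasure (K (fst z)) {..<snd z}) \<in> borel_measurable (N \<Otimes>\<^sub>M borel)"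
    by (rule emeasure_measurable_subprob_algebra2) measurable
  show ?thesis
    unfolding randomized_pit_def cdf_def measure_def split_def by measurable
qed

section \<open>From conditional c.d.f.s to kernels\<close>

text \<open>The laws are chosen separately for each configuration. They still vary measurably, since
  their masses of half-lines are the measurable functions \<open>F x y\<close> and half-lines are an
  intersection-stable generator of the Borel sets.\<close>

lemma conditional_cdf_kernelE:
  assumes "conditional_cdf M F"
  obtains K where "K \<in> Pi\<^sub>M M (\<lambda>_. borel) \<rightarrow>\<^sub>M prob_algebra borel"
    and "\<And>x. x \<in> space (Pi\<^sub>M M (\<lambda>_. borel)) \<Longrightarrow> real_distribution (K x)"
    and "\<And>x. x \<in> space (Pi\<^sub>M M (\<lambda>_. borel)) \<Longrightarrow> F x = cdf (K x)"
proof -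
  let ?N = "Pi\<^sub>M M (\<lambda>_. borel :: real measure)"
  obtain K where K: "\<And>x. x \<in> space ?N \<Longrightarrow> real_distribution (K x)"
      "\<And>x. x \<in> space ?N \<Longrightarrow> F x = cdf (K x)"
    using assms unfolding conditional_cdf_def by metis
  have "K \<in> ?N \<rightarrow>\<^sub>M prob_algebra borel"
  proof (rule measurable_prob_algebra_generated)
    show "sets borel = sigma_sets UNIV (range (atMost :: real \<Rightarrow> _))"
      by (subst borel_eq_atMost) simp
    show "Int_stable (range (atMost :: real \<Rightarrow> _))"
      by (auto simp: Int_stable_def)
    show "prob_space (K x)" "sets (K x) = sets borel" if "x \<in> space ?N" for x
    proof -
      interpret real_distribution "K x" using K(1) that .
      show "prob_space (K x)" "sets (K x) = sets borel" by unfold_locales simp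
    qed
    fix S :: "real set" assume "S \<in> range atMost"
    then obtain y where S: "S = {..y}" by auto
    have "(\<lambda>x. ennreal (F x y)) \<in> borel_measurable ?N"
      using assms unfolding conditional_cdf_def by (intro measurable_compose[OF _ measurable_ennreal]) simp
    also have "?this \<longleftrightarrow> (\<lambda>x. emeasure (K x) S) \<in> borel_measurable ?N"
    proof (rule measurable_cong)
      fix x assume x: "x \<in> space ?N"
      interpret real_distribution "K x" using K(1) x .
      show "ennreal (F x y) = emeasure (K x) S"
        using K(2)[OF x] by (simp add: cdf_def S emeasure_eq_measure)
    qed
    finally show "(\<lambda>x. emeasure (K x) S) \<in> borel_measurable ?N" .
  qed auto
  then show ?thesis using K that by blast
qed

lemma left_limit_cdf_eq:
  assumes "real_distribution D" "F x = cdf D"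
  shows "left_limit_cdf F x y = measure D {..<y}"
proof -
  interpret real_distribution D by fact
  show ?thesis unfolding left_limit_cdf_def assms(2) by (intro tendsto_Lim cdf_at_left) simp
qed

text \<open>This is the defining property of conditional expectation, averaged over an event
  generated by the remaining variables. It has the form that
  \<open>nn_integral_disintegration\<close> asks for.\<close>

lemma emeasure_has_conditional_cdf:
  fixes Y :: "int ^ 'd \<Rightarrow> 'w \<Rightarrow> real"
  assumes "prob_space P" and Y [measurable]: "\<And>t. Y t \<in> borel_measurable P"
    and F: "conditional_cdf M F" "has_conditional_cdf P M Y F s"
    and E: "E \<in> sets (Pi\<^sub>M (- {s}) (\<lambda>_. borel))"
  shows "emeasure P {\<omega> \<in> space P. (\<lambda>t\<in>- {s}. Y t \<omega>) \<in> E \<and> Y s \<omega> \<le> y}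
    = (\<integral>\<^sup>+\<omega>. indicator E (\<lambda>t\<in>- {s}. Y t \<omega>) * ennreal (F (neighbor_values M Y s \<omega>) y) \<partial>P)"
proof -
  interpret P: prob_space P by fact
  let ?W = "\<lambda>\<omega>. \<lambda>t\<in>- {s}. Y t \<omega>" and ?G = "sigma_remaining P Y s"
  let ?I = "indicator {\<omega> \<in> space P. Y s \<omega> \<le> y} :: 'w \<Rightarrow> real"
  let ?F = "\<lambda>\<omega>. F (neighbor_values M Y s \<omega>) y"
  have W [measurable]: "?W \<in> P \<rightarrow>\<^sub>M Pi\<^sub>M (- {s}) (\<lambda>_. borel)" by measurable
  have "subalgebra P ?G"
    unfolding subalgebra_def sigma_remaining_def using measurable_sets[OF W]
    by (auto simp: sets_vimage_algebra2[OF measurable_space[OF W, THEN funcsetI]])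
  then interpret finite_measure_subalgebra P ?G
    by unfold_locales
  have nv [measurable]: "neighbor_values M Y s \<in> P \<rightarrow>\<^sub>M Pi\<^sub>M M (\<lambda>_. borel)"
    unfolding neighbor_values_def[abs_def] by measurable
  have F_measurable [measurable]: "?F \<in> borel_measurable P"
    using F(1) by (intro measurable_compose[OF nv]) (simp add: conditional_cdf_def)
  \<comment> \<open>These bounds give integrability and allow the passage between the real-valued
    and the nonnegative integral.\<close>
  have F01: "0 \<le> ?F \<omega>" "?F \<omega> \<le> 1" if \<omega>: "\<omega> \<in> space P" for \<omega>
  proof -
    obtain D where "real_distribution D" "F (neighbor_values M Y s \<omega>) = cdf D"
      using F(1) measurable_space[OF nv \<omega>] unfolding conditional_cdf_def by blast
    then interpret real_distribution D by simp
    show "0 \<le> ?F \<omega>" "?F \<omega> \<le> 1"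
      using cdf_nonneg cdf_bounded_prob \<open>F _ = cdf D\<close> by auto
  qed
  let ?A = "?W -` E \<inter> space P"
  have A [measurable]: "?A \<in> sets P" using E by measurable
  have "?A \<in> sets ?G"
    unfolding sigma_remaining_def using E by (rule in_vimage_algebra)
  have "measure P (?A \<inter> {\<omega> \<in> space P. Y s \<omega> \<le> y}) = (\<integral>\<omega>\<in>?A. ?I \<omega> \<partial>P)"
    by (simp add: set_lebesgue_integral_def indicator_inter_arith[symmetric] Int_assoc)
  also have "\<dots> = (\<integral>\<omega>\<in>?A. real_cond_exp P ?G ?I \<omega> \<partial>P)"
    using \<open>?A \<in> sets ?G\<close> by (intro real_cond_exp_intA P.integrable_const_bound[where B=1]) auto
  \<comment> \<open>For the fixed \<open>y\<close> the two integrands agree almost everywhere, which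
    suffices under the integral.\<close>
  also have "\<dots> = (\<integral>\<omega>\<in>?A. ?F \<omega> \<partial>P)"
    using F(2) unfolding set_lebesgue_integral_def has_conditional_cdf_def
    by (intro integral_cong_AE) (auto elim!: eventually_mono)
  finally have eq: "measure P (?A \<inter> {\<omega> \<in> space P. Y s \<omega> \<le> y}) = (\<integral>\<omega>. indicator ?A \<omega> * ?F \<omega> \<partial>P)"
    by (simp add: set_lebesgue_integral_def)
  have "(\<integral>\<^sup>+\<omega>. indicator E (?W \<omega>) * ennreal (?F \<omega>) \<partial>P) = (\<integral>\<^sup>+\<omega>. ennreal (indicator ?A \<omega> * ?F \<omega>) \<partial>P)"
    by (intro nn_integral_cong) (auto simp: indicator_def)
  also have "\<dots> = ennreal (\<integral>\<omega>. indicator ?A \<omega> * ?F \<omega> \<partial>P)"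
  proof (rule nn_integral_eq_integral)
    show "integrable P (\<lambda>\<omega>. indicator ?A \<omega> * ?F \<omega>)"
    proof (rule P.integrable_const_bound[where B=1])
      show "(\<lambda>\<omega>. indicator ?A \<omega> * ?F \<omega>) \<in> borel_measurable P" by measurable
    qed (use F01 in \<open>auto simp: indicator_def\<close>)
  qed (use F01 in \<open>auto simp: indicator_def\<close>)
  also have "\<dots> = emeasure P (?A \<inter> {\<omega> \<in> space P. Y s \<omega> \<le> y})"
    unfolding eq[symmetric] P.emeasure_eq_measure ..
  also have "?A \<inter> {\<omega> \<in> space P. Y s \<omega> \<le> y} = {\<omega> \<in> space P. ?W \<omega> \<in> E \<and> Y s \<omega> \<le> y}" by auto
  finally show ?thesis by (rule sym)
qed

section \<open>Integration over a conclique\<close>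

text \<open>The function reads no coordinate outside \<open>I\<close>. With \<open>I = - {s}\<close>
  this expresses that the value at \<open>s\<close> does not enter.\<close>

lemma borel_measurable_neighborhood:
  fixes t :: "int ^ 'd"
  assumes f: "f \<in> borel_measurable (Pi\<^sub>M M (\<lambda>_. borel) \<Otimes>\<^sub>M (borel :: real measure))"
    and I: "t \<in> I" "neighbors M t \<subseteq> I"
  shows "(\<lambda>\<eta>. f (\<lambda>m\<in>M. \<eta> (t + m), \<eta> t)) \<in> borel_measurable (Pi\<^sub>M I (\<lambda>_. borel))"
proof (rule measurable_compose[OF _ f], rule measurable_Pair)
  show "(\<lambda>\<eta>. \<lambda>m\<in>M. \<eta> (t + m)) \<in> Pi\<^sub>M I (\<lambda>_. borel) \<rightarrow>\<^sub>M Pi\<^sub>M M (\<lambda>_. borel)"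
    using I(2) by (intro measurable_restrict measurable_component_singleton) (auto simp: neighbors_def)
qed (intro measurable_component_singleton I)

text \<open>The conclique condition is taken with \<open>t\<close> as the centre: \<open>s\<close>
  is not a neighbor of \<open>t\<close>.\<close>

lemma conclique_neighbors:
  assumes "conclique M C" "s \<in> C" "t \<in> C" "s \<noteq> t"
  shows "t \<in> - {s}" "neighbors M t \<subseteq> - {s}"
  using assms by (auto simp: conclique_def)

text \<open>\<open>\<Phi> t\<close> is the conditional probability, given \<open>Y\<close>, that the residual at \<open>t\<close> lies in \<open>B t\<close>. The sites
  of \<open>J\<close> are split off one at a time: by the conclique property \<open>\<Phi> t\<close> does not look at \<open>Y s\<close> when
  \<open>t \<noteq> s\<close>, so \<open>Y s\<close> can be integrated out against its conditional law first.\<close>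

lemma nn_integral_conclique:
  fixes Y :: "int ^ 'd \<Rightarrow> 'w \<Rightarrow> real" and K :: "(int ^ 'd \<Rightarrow> real) \<Rightarrow> real measure"
  assumes "prob_space P" and Y [measurable]: "\<And>t. Y t \<in> borel_measurable P" and "0 \<notin> M"
    and F: "conditional_cdf M F" "\<And>s. has_conditional_cdf P M Y F s"
    and K [measurable]: "K \<in> Pi\<^sub>M M (\<lambda>_. borel) \<rightarrow>\<^sub>M prob_algebra borel"
    and K_distr: "\<And>x. x \<in> space (Pi\<^sub>M M (\<lambda>_. borel)) \<Longrightarrow> real_distribution (K x)"
    and K_cdf: "\<And>x. x \<in> space (Pi\<^sub>M M (\<lambda>_. borel)) \<Longrightarrow> F x = cdf (K x)"
    and C: "conclique M C" and J: "finite J" "J \<subseteq> C" and B: "\<And>t. t \<in> J \<Longrightarrow> B t \<in> sets borel"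
  defines "\<Phi> \<equiv> \<lambda>t \<eta>. emeasure uniform01 {a. randomized_pit (K (\<lambda>m\<in>M. \<eta> (t + m))) (\<eta> t) a \<in> B t}"
  shows "(\<integral>\<^sup>+\<omega>. (\<Prod>t\<in>J. \<Phi> t (\<lambda>s. Y s \<omega>)) \<partial>P) = (\<Prod>t\<in>J. emeasure uniform01 (B t))"
  using J B
proof (induction J rule: finite_induct)
  case empty
  then show ?case using prob_space.emeasure_space_1[OF \<open>prob_space P\<close>] by simp
next
  case (insert s J)
  interpret P: prob_space P by fact
  interpret U: real_distribution uniform01 by (fact real_distribution_uniform01)
  let ?W = "\<lambda>\<omega>. \<lambda>t\<in>- {s}. Y t \<omega>" and ?N = "Pi\<^sub>M (- {s}) (\<lambda>_. borel :: real measure)"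
  let ?x = "\<lambda>w. \<lambda>m\<in>M. w (s + m)"
  \<comment> \<open>This is \<open>\<Phi> t\<close> with the neighboring configuration and the value
    at \<open>t\<close> as separate arguments, so that one can be integrated while the other is
    fixed.\<close>
  let ?\<phi> = "\<lambda>t (x, y). emeasure uniform01 {a. randomized_pit (K x) y a \<in> B t}"
  have \<phi>: "?\<phi> t \<in> borel_measurable (Pi\<^sub>M M (\<lambda>_. borel) \<Otimes>\<^sub>M borel)" if "t \<in> insert s J" for t
  proof -
    let ?Q = "(Pi\<^sub>M M (\<lambda>_. borel :: real measure) \<Otimes>\<^sub>M borel) \<Otimes>\<^sub>M (borel :: real measure)"
    let ?R = "\<lambda>((x, y), a). randomized_pit (K x) y a"
    have "?R -` B t \<inter> space ?Q \<in> sets ?Q"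
      using insert.prems(2)[OF that] borel_measurable_randomized_pit_kernel[OF K]
      by (rule measurable_sets[rotated])
    then have "?R -` B t \<inter> space ?Q \<in> sets ((Pi\<^sub>M M (\<lambda>_. borel) \<Otimes>\<^sub>M borel) \<Otimes>\<^sub>M uniform01)"
      by (simp add: sets_pair_measure_cong[OF refl, of uniform01 borel])
    from U.measurable_emeasure_Pair[OF this] show ?thesis
      by (rule measurable_cong[THEN iffD1, rotated])
         (auto simp: space_pair_measure intro!: arg_cong[where f="emeasure uniform01"])
  qed
  \<comment> \<open>Since \<open>0 \<notin> M\<close>, no \<open>s + m\<close> equals
    \<open>s\<close>, and all neighboring values of \<open>s\<close> are among the remaining
    variables.\<close>
  have x [measurable]: "?x \<in> ?N \<rightarrow>\<^sub>M Pi\<^sub>M M (\<lambda>_. borel)"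
    using \<open>0 \<notin> M\<close> by (intro measurable_restrict measurable_component_singleton) auto
  have \<Phi>_W: "\<Phi> t (\<lambda>s. Y s \<omega>) = \<Phi> t (?W \<omega>)" and \<Phi>_measurable: "\<Phi> t \<in> borel_measurable ?N" if "t \<in> J" for t \<omega>
  proof -
    have "t \<in> - {s}" "neighbors M t \<subseteq> - {s}"
      using conclique_neighbors[OF C, of s t] insert that by auto
    then have "(\<lambda>m\<in>M. Y (t + m) \<omega>) = (\<lambda>m\<in>M. ?W \<omega> (t + m))"
      by (intro restrict_ext) (auto simp: neighbors_def)
    then show "\<Phi> t (\<lambda>s. Y s \<omega>) = \<Phi> t (?W \<omega>)"
      using \<open>t \<in> - {s}\<close> unfolding \<Phi>_def by simp
    show "\<Phi> t \<in> borel_measurable ?N"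
      using borel_measurable_neighborhood[OF \<phi>, of t t "- {s}"] \<open>t \<in> - {s}\<close> \<open>neighbors M t \<subseteq> - {s}\<close> that
      by (simp add: \<Phi>_def)
  qed
  \<comment> \<open>Only the first factor depends on \<open>y\<close>, the value at
    \<open>s\<close>; the product over \<open>J\<close> is a function of the remaining
    variables.\<close>
  define f where "f = (\<lambda>(w, y). ?\<phi> s (?x w, y) * (\<Prod>t\<in>J. \<Phi> t w))"
  have f: "f \<in> borel_measurable (?N \<Otimes>\<^sub>M borel)"
  proof -
    have "(\<lambda>z. (?x (fst z), snd z)) \<in> ?N \<Otimes>\<^sub>M borel \<rightarrow>\<^sub>M Pi\<^sub>M M (\<lambda>_. borel) \<Otimes>\<^sub>M borel"
      by (intro measurable_Pair measurable_compose[OF measurable_fst x] measurable_snd)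
    then have "(\<lambda>z. ?\<phi> s (?x (fst z), snd z)) \<in> borel_measurable (?N \<Otimes>\<^sub>M borel)"
      by (rule measurable_compose[OF _ \<phi>]) simp
    moreover have "(\<lambda>z. \<Prod>t\<in>J. \<Phi> t (fst z)) \<in> borel_measurable (?N \<Otimes>\<^sub>M borel)"
      by (intro borel_measurable_prod_ennreal measurable_compose[OF measurable_fst \<Phi>_measurable])
    ultimately have "(\<lambda>z. ?\<phi> s (?x (fst z), snd z) * (\<Prod>t\<in>J. \<Phi> t (fst z))) \<in> borel_measurable (?N \<Otimes>\<^sub>M borel)"
      by (rule borel_measurable_times_ennreal)
    then show ?thesis by (simp add: f_def split_def)
  qed
  have W: "?W \<in> P \<rightarrow>\<^sub>M ?N" by measurable
  have nv: "neighbor_values M Y s \<omega> = ?x (?W \<omega>)" for \<omega>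
    using \<open>0 \<notin> M\<close> by (auto simp: neighbor_values_def fun_eq_iff restrict_def)
  have xW: "?x (?W \<omega>) \<in> space (Pi\<^sub>M M (\<lambda>_. borel))" for \<omega>
    by (simp add: space_PiM)
  have \<Phi>_s: "\<Phi> s (\<lambda>t. Y t \<omega>) = ?\<phi> s (?x (?W \<omega>), Y s \<omega>)" for \<omega>
    using nv[of \<omega>, symmetric] by (simp add: \<Phi>_def neighbor_values_def)
  have "(\<integral>\<^sup>+\<omega>. (\<Prod>t\<in>insert s J. \<Phi> t (\<lambda>s. Y s \<omega>)) \<partial>P) = (\<integral>\<^sup>+\<omega>. f (?W \<omega>, Y s \<omega>) \<partial>P)"
    using insert.hyps \<Phi>_W by (simp add: f_def \<Phi>_s del: restrict_apply cong: prod.cong)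
  \<comment> \<open>The kernel looks at the neighbors of \<open>s\<close> only, yet it is the
    conditional law given all of \<open>?W\<close>: this is the Markov property contained in
    \<open>has_conditional_cdf\<close>.\<close>
  also have "\<dots> = (\<integral>\<^sup>+\<omega>. \<integral>\<^sup>+y. f (?W \<omega>, y) \<partial>K (?x (?W \<omega>)) \<partial>P)"
  proof (rule P.nn_integral_disintegration[OF W Y _ _ f, where K="\<lambda>w. K (?x w)"])
    fix E y assume "E \<in> sets ?N"
    have "ennreal (F (?x (?W \<omega>)) y) = emeasure (K (?x (?W \<omega>))) {..y}" for \<omega>
    proof -
      interpret real_distribution "K (?x (?W \<omega>))" using K_distr xW .
      show ?thesis using K_cdf[OF xW] by (simp only: cdf_def emeasure_eq_measure)
    qed
    then show "emeasure P {\<omega> \<in> space P. ?W \<omega> \<in> E \<and> Y s \<omega> \<le> y}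
        = (\<integral>\<^sup>+\<omega>. indicator E (?W \<omega>) * emeasure (K (?x (?W \<omega>))) {..y} \<partial>P)"
      using emeasure_has_conditional_cdf[OF \<open>prob_space P\<close> Y F \<open>E \<in> sets ?N\<close>, of y]
      by (simp only: nv)
  qed (rule measurable_compose[OF x K])
  \<comment> \<open>The transform is uniform under each of the laws
    \<open>K (?x (?W \<omega>))\<close>, so the factor of \<open>s\<close> integrates to the same
    constant for every \<open>\<omega>\<close>.\<close>
  also have "\<dots> = (\<integral>\<^sup>+\<omega>. emeasure uniform01 (B s) * (\<Prod>t\<in>J. \<Phi> t (?W \<omega>)) \<partial>P)"
  proof (rule nn_integral_cong)
    fix \<omega>
    interpret K: real_distribution "K (?x (?W \<omega>))" using K_distr xW .
    have "(\<lambda>y. ?\<phi> s (?x (?W \<omega>), y)) \<in> borel_measurable (K (?x (?W \<omega>)))"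
      unfolding measurable_cong_sets[OF K.events_eq_borel refl]
      using measurable_compose[OF measurable_Pair1'[OF xW[of \<omega>]] \<phi>[of s]] by simp
    then show "(\<integral>\<^sup>+y. f (?W \<omega>, y) \<partial>K (?x (?W \<omega>))) = emeasure uniform01 (B s) * (\<Prod>t\<in>J. \<Phi> t (?W \<omega>))"
      using nn_integral_randomized_pit[OF K_distr[OF xW], of "B s" \<omega>] insert.prems(2)
      by (simp add: f_def nn_integral_multc del: restrict_apply)
  qed
  \<comment> \<open>The constant moves out, and \<open>\<Phi>_W\<close> leads back from
    \<open>?W\<close> to the full process, where the induction hypothesis applies.\<close>
  also have "\<dots> = emeasure uniform01 (B s) * (\<integral>\<^sup>+\<omega>. (\<Prod>t\<in>J. \<Phi> t (\<lambda>s. Y s \<omega>)) \<partial>P)"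
    using \<Phi>_W by (subst nn_integral_cmult)
      (auto intro!: borel_measurable_prod_ennreal measurable_compose[OF W \<Phi>_measurable] simp del: restrict_apply)
  also have "\<dots> = (\<Prod>t\<in>insert s J. emeasure uniform01 (B t))"
    using insert by simp
  finally show ?case .
qed

section \<open>The joint law of the residuals\<close>

theorem theorem2p1:
  fixes P :: "'w measure"
    and Y A :: "int ^ 'd \<Rightarrow> 'w \<Rightarrow> real"
    and M :: "(int ^ 'd) set"
    and F :: "(int ^ 'd \<Rightarrow> real) \<Rightarrow> real \<Rightarrow> real"
    and C :: "nat \<Rightarrow> (int ^ 'd) set"
    and q :: nat
  assumes "prob_space P"
    and "\<And>s. Y s \<in> borel_measurable P"
    and "finite M" and "0 \<notin> M"
    and "conditional_cdf M F"
    and "\<And>s. has_conditional_cdf P M Y F s"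
    and "iid_uniform P A UNIV"
    and "independent_processes P A Y"
    and "\<And>j. j \<in> {1..q} \<Longrightarrow> conclique M (C j)"
    and "partition_on UNIV (C ` {1..q})" and "inj_on C {1..q}"
  shows "\<forall>j\<in>{1..q}. iid_uniform P (spatial_residual M F Y A) (C j)"
proof
  fix j assume "j \<in> {1..q}"
  then have C: "conclique M (C j)" by (fact assms)
  interpret P: prob_space P by fact
  interpret U: real_distribution uniform01 by (fact real_distribution_uniform01)
  note [measurable] = assms(2)
  let ?N = "Pi\<^sub>M M (\<lambda>_. borel :: real measure)"
  let ?Y = "\<lambda>\<omega> s. Y s \<omega>" and ?L = "Pi\<^sub>M UNIV (\<lambda>_ :: int ^ 'd. borel :: real measure)"
  obtain K where K: "K \<in> ?N \<rightarrow>\<^sub>M prob_algebra borel"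
      and K_distr: "\<And>x. x \<in> space ?N \<Longrightarrow> real_distribution (K x)"
      and K_cdf: "\<And>x. x \<in> space ?N \<Longrightarrow> F x = cdf (K x)"
    using conditional_cdf_kernelE[OF assms(5)] by metis
  \<comment> \<open>The residual as a function of the full process and a single uniform variable, so
    that the latter can be integrated with the process fixed.\<close>
  define R where "R t \<eta> a = randomized_pit (K (\<lambda>m\<in>M. \<eta> (t + m))) (\<eta> t) a" for t \<eta> a
  have residual: "spatial_residual M F Y A t \<omega> = R t (?Y \<omega>) (A t \<omega>)" for t \<omega>
  proof -
    have x: "neighbor_values M Y t \<omega> \<in> space ?N" by (simp add: neighbor_values_def space_PiM)
    show ?thesis
      unfolding spatial_residual_def R_def randomized_pit_def left_limit_cdf_eq[of "K _" F, OF K_distr[OF x] K_cdf[OF x]]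
      by (simp add: K_cdf[OF x]) (simp add: neighbor_values_def)
  qed
  have A_indep: "P.indep_vars (\<lambda>_. borel) A UNIV" and A_distr: "\<And>t. distr P borel (A t) = uniform01"
    using assms(7) by (auto simp: iid_uniform_def)
  have A [measurable]: "A t \<in> borel_measurable P" for t
    using A_indep by (simp add: P.indep_vars_def)
  have R [measurable]: "(\<lambda>(\<eta>, a). R t \<eta> a) \<in> borel_measurable (?L \<Otimes>\<^sub>M borel)" for t
  proof -
    have "(\<lambda>z. ((\<lambda>m\<in>M. fst z (t + m), fst z t), snd z)) \<in> ?L \<Otimes>\<^sub>M borel \<rightarrow>\<^sub>M (?N \<Otimes>\<^sub>M borel) \<Otimes>\<^sub>M borel"
      by measurable
    from measurable_compose[OF this borel_measurable_randomized_pit_kernel[OF K]]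
    show ?thesis by (simp add: R_def split_def)
  qed
  have U_measurable [measurable]: "spatial_residual M F Y A t \<in> borel_measurable P" for t
  proof -
    have "(\<lambda>\<omega>. (?Y \<omega>, A t \<omega>)) \<in> P \<rightarrow>\<^sub>M ?L \<Otimes>\<^sub>M borel"
      by (intro measurable_Pair A measurable_PiM_single') auto
    from measurable_compose[OF this R] show ?thesis by (simp add: residual[abs_def])
  qed
  \<comment> \<open>\<open>J\<close> is nonempty because an empty intersection would be
    \<open>UNIV\<close>, which may differ from \<open>space P\<close>.\<close>
  have joint: "emeasure P (\<Inter>t\<in>J. spatial_residual M F Y A t -` B t \<inter> space P) = (\<Prod>t\<in>J. emeasure uniform01 (B t))"
    if J: "finite J" "J \<noteq> {}" "J \<subseteq> C j" and B: "\<And>t. t \<in> J \<Longrightarrow> B t \<in> sets borel" for J B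
  proof -
    define g where "g t = (\<lambda>(\<eta>, a). indicator (B t) (R t \<eta> a) :: ennreal)" for t
    have g: "g t \<in> borel_measurable (?L \<Otimes>\<^sub>M borel)" if "t \<in> J" for t
      using measurable_compose[OF R borel_measurable_indicator[OF B[OF that]]]
      by (simp add: g_def split_def)
    have "P.indep_var ?L (\<lambda>\<omega> s. A s \<omega>) ?L ?Y"
      using assms(8) by (simp add: independent_processes_def)
    \<comment> \<open>Only \<open>A\<close> is restricted to \<open>J\<close>; \<open>Y\<close>
      stays whole, since the residuals also read neighbors outside \<open>J\<close>.\<close>
    then have "P.indep_var (Pi\<^sub>M J (\<lambda>_. borel)) ((\<lambda>a. restrict a J) \<circ> (\<lambda>\<omega> s. A s \<omega>)) ?L ((\<lambda>\<eta>. \<eta>) \<circ> ?Y)"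
      by (rule P.indep_var_compose) (auto intro: measurable_restrict_subset)
    then have AY: "P.indep_var (Pi\<^sub>M J (\<lambda>_. borel)) (\<lambda>\<omega>. \<lambda>t\<in>J. A t \<omega>) ?L ?Y"
      by (simp add: comp_def)
    have inter: "(\<Inter>t\<in>J. spatial_residual M F Y A t -` B t \<inter> space P) \<in> sets P"
      using J B by (intro sets.finite_INT measurable_sets[OF U_measurable]) auto
    have "emeasure P (\<Inter>t\<in>J. spatial_residual M F Y A t -` B t \<inter> space P)
        = (\<integral>\<^sup>+\<omega>. (\<Prod>t\<in>J. g t (?Y \<omega>, A t \<omega>)) \<partial>P)"
      unfolding nn_integral_indicator[OF inter, symmetric]
    proof (rule nn_integral_cong)
      fix \<omega> assume "\<omega> \<in> space P"
      then show "indicator (\<Inter>t\<in>J. spatial_residual M F Y A t -` B t \<inter> space P) \<omega>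
          = (\<Prod>t\<in>J. g t (?Y \<omega>, A t \<omega>))"
        using J(1,2) by (auto simp: g_def residual[symmetric] indicator_def)
    qed
    also have "\<dots> = (\<integral>\<^sup>+\<omega>. (\<Prod>t\<in>J. \<integral>\<^sup>+a. g t (?Y \<omega>, a) \<partial>uniform01) \<partial>P)"
      using J(1) AY A_distr P.indep_vars_subset[OF A_indep] g
      by (intro P.nn_integral_prod_iid_indep[where S=borel] U.prob_space_axioms) auto
    also have "\<dots> = (\<integral>\<^sup>+\<omega>. (\<Prod>t\<in>J. emeasure uniform01 {a. R t (?Y \<omega>) a \<in> B t}) \<partial>P)"
    proof (intro nn_integral_cong prod.cong refl)
      fix \<omega> t assume "t \<in> J"
      have "(\<lambda>a. R t (?Y \<omega>) a) \<in> borel_measurable borel"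
        using measurable_compose[OF measurable_Pair1'[of "?Y \<omega>" ?L borel] R] by (simp add: space_PiM)
      from measurable_sets[OF this B[OF \<open>t \<in> J\<close>]] have "{a. R t (?Y \<omega>) a \<in> B t} \<in> sets borel"
        by (simp add: vimage_def)
      then show "(\<integral>\<^sup>+a. g t (?Y \<omega>, a) \<partial>uniform01) = emeasure uniform01 {a. R t (?Y \<omega>) a \<in> B t}"
        by (subst nn_integral_indicator[symmetric])
          (simp, auto simp only: g_def indicator_def mem_Collect_eq prod.case intro!: nn_integral_cong)
    qed
    also have "\<dots> = (\<Prod>t\<in>J. emeasure uniform01 (B t))"
      unfolding R_def using assms(1,2,4-6) K K_distr K_cdf C J(1,3) B by (rule nn_integral_conclique)
    finally show ?thesis .
  qed
  \<comment> \<open>One-point subfamilies give the marginal laws.\<close>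
  have single: "emeasure P (spatial_residual M F Y A t -` B \<inter> space P) = emeasure uniform01 B"
    if "t \<in> C j" "B \<in> sets borel" for t B
    using joint[of "{t}" "\<lambda>_. B"] that by simp
  have "P.indep_vars (\<lambda>_. borel) (spatial_residual M F Y A) (C j)"
    unfolding P.indep_vars_def2
  proof (intro conjI ballI P.indep_setsI)
    fix S J assume J: "J \<noteq> {}" "J \<subseteq> C j" "finite J"
      and "\<forall>t\<in>J. S t \<in> {spatial_residual M F Y A t -` B \<inter> space P |B. B \<in> sets borel}"
    then obtain B where B: "\<And>t. t \<in> J \<Longrightarrow> B t \<in> sets borel"
        and S: "\<And>t. t \<in> J \<Longrightarrow> S t = spatial_residual M F Y A t -` B t \<inter> space P"
      by (auto simp: subset_iff) metis
    \<comment> \<open>By \<open>single\<close>, each uniform factor in \<open>joint\<close> is the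
      probability of the corresponding event, which turns \<open>joint\<close> into the product
      rule.\<close>
    have "emeasure P (\<Inter>t\<in>J. S t) = (\<Prod>t\<in>J. emeasure P (S t))"
      using joint[OF J(3,1,2), of B] B J(2) by (simp add: S single subset_iff cong: INF_cong_simp)
    then show "measure P (\<Inter>t\<in>J. S t) = (\<Prod>t\<in>J. measure P (S t))"
      by (simp add: P.emeasure_eq_measure prod_ennreal prod_nonneg)
  qed auto
  moreover have "distr P borel (spatial_residual M F Y A t) = uniform01" if "t \<in> C j" for t
    using single[OF that] by (intro measure_eqI) (simp_all add: emeasure_distr)
  ultimately show "iid_uniform P (spatial_residual M F Y A) (C j)"
    by (simp add: iid_uniform_def)
qed

end
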